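(* For every integer $n\ge 1$, $$\sum_{G\in\mathcal{C}_n} w(G)=(-1)^n (n+1)^n,$$ where $\mathcal{C}_n$ is the set of connected graphs with vertex set $\{0,1,\ldots,n\}$, and for $G\in\mathcal{C}_n$, $w(G)=(-1)^{e(G)}\,\mathrm{Vol}(\Pi_G)$, with $e(G)$ the number of edges of $G$ and $\mathrm{Vol}(\Pi_G)$ the $n$-dimensional volume of the polytope $$\Pi_G=\{(x_1,\ldots,x_n)\in\mathbb{R}^n : |x_i-x_j|\le 1 \text{ for every edge } (i,j) \text{ of } G\},\qquad \text{with the convention } x_0=0.$$
   Context: Graphs are simple, undirected and labelled: the sum runs over all connected labelled graphs on the fixed vertex set $\{0,1,\ldots,n\}$ (not isomorphism classes). Volume means Lebesgue measure on $\mathbb{R}^n$. *)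

theory Defs
  imports "HOL-Analysis.Analysis"
begin

(* The vertex set {0..n} is fixed, so a labelled simple graph on it is given by its edge set,
   a set of two-element subsets of {0..n}. *)
definition simple_graphs :: "nat \<Rightarrow> nat set set set" where
  "simple_graphs n = Pow {e. e \<subseteq> {0..n} \<and> card e = 2}"

definition connected_graph :: "nat \<Rightarrow> nat set set \<Rightarrow> bool" where
  "connected_graph n G \<longleftrightarrow> (\<forall>u\<in>{0..n}. \<forall>v\<in>{0..n}. (u, v) \<in> {(i, j). {i, j} \<in> G}\<^sup>*)"

definition connected_graphs :: "nat \<Rightarrow> nat set set set" where
  "connected_graphs n = {G \<in> simple_graphs n. connected_graph n G}"

(* Points of R^n are functions on {1..n}, extensional as in the space of the product measure;
   the update x(0 := 0) implements the convention x_0 = 0. *)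
definition graph_polytope :: "nat \<Rightarrow> nat set set \<Rightarrow> (nat \<Rightarrow> real) set" where
  "graph_polytope n G =
     {x \<in> {1..n} \<rightarrow>\<^sub>E UNIV. \<forall>i j. {i, j} \<in> G \<longrightarrow> \<bar>(x(0 := 0)) i - (x(0 := 0)) j\<bar> \<le> 1}"

(* The n-fold product of lborel is n-dimensional Lebesgue measure on Borel sets, and
   graph_polytope is closed; see graph_polytope_measurable. *)
definition graph_volume :: "nat \<Rightarrow> nat set set \<Rightarrow> real" where
  "graph_volume n G = measure (Pi\<^sub>M {1..n} (\<lambda>_. lborel)) (graph_polytope n G)"

definition graph_weight :: "nat \<Rightarrow> nat set set \<Rightarrow> real" where
  "graph_weight n G = (-1) ^ card G * graph_volume n G"

lemma finite_connected_graphs: "finite (connected_graphs n)"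
proof -
  have "finite {e. e \<subseteq> {0..n} \<and> card e = 2}"
    by (rule finite_subset[of _ "Pow {0..n}"]) auto
  then show ?thesis
    by (simp add: connected_graphs_def simple_graphs_def)
qed

lemma graph_polytope_measurable:
  assumes "G \<in> simple_graphs n"
  shows "graph_polytope n G \<in> sets (Pi\<^sub>M {1..n} (\<lambda>_. lborel))"
proof -
  let ?M = "Pi\<^sub>M {1..n} (\<lambda>_. lborel :: real measure)"
  have coord: "(\<lambda>x. (x(0 := 0)) i) \<in> borel_measurable ?M" if "i \<le> n" for i
  proof (cases "i = 0")
    case False
    with that have "i \<in> {1..n}" by auto
    then have "(\<lambda>x. x i) \<in> measurable ?M lborel"
      by (rule measurable_component_singleton)
    with False show ?thesis by simp
  qed simp
  have "{x \<in> space ?M. {i, j} \<in> G \<longrightarrow> \<bar>(x(0 := 0)) i - (x(0 := 0)) j\<bar> \<le> 1} \<in> sets ?M" for i j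
  proof (cases "{i, j} \<in> G")
    case True
    with assms have "i \<le> n" "j \<le> n" by (auto simp: simple_graphs_def)
    then have "(\<lambda>x. \<bar>(x(0 := 0)) i - (x(0 := 0)) j\<bar>) \<in> borel_measurable ?M"
      by (intro borel_measurable_abs borel_measurable_diff coord)
    from borel_measurable_le[OF this borel_measurable_const[of 1]] True
    show ?thesis by simp
  qed simp
  then have "{x \<in> space ?M. \<forall>i j. {i, j} \<in> G \<longrightarrow> \<bar>(x(0 := 0)) i - (x(0 := 0)) j\<bar> \<le> 1} \<in> sets ?M"
    by (intro sets.sets_Collect_countable_All) 
  then show ?thesis
    by (simp add: graph_polytope_def space_PiM)
qed

end

theory Submission
  imports Defs
begin

text \<open>
  Write the sum of weights as one integral over \<open>x\<close> of the sum of \<open>(-1)^e(G)\<close>, taken over the connected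
  graphs \<open>G\<close> contained in the unit interval graph of the points \<open>x\<^sub>0 = 0, x\<^sub>1, \<dots>, x\<^sub>n\<close>. In such a graph the
  neighbours of the rightmost point form a clique, so a sign-reversing involution shows that removing
  this point divides the sum by minus its degree. Hence the integrand is \<open>(-1)^n\<close> times the number of
  ways of choosing, for every point except the leftmost, a point at distance at most 1 to its left,
  that is, of rooted trees increasing along the line with edges of length at most 1. For a fixed rooted
  tree these \<open>x\<close> form a set of volume 1, and there are \<open>(n+1)^n\<close> rooted labelled trees.
\<close>

section \<open>Alternating sums over connected subgraphs\<close>

text \<open>Connectedness with the vertex set as a parameter, since the induction below deletes
  vertices.\<close>

definition spans :: "'a set \<Rightarrow> 'a set set \<Rightarrow> bool" where
  "spans V G \<longleftrightarrow> (\<forall>u\<in>V. \<forall>v\<in>V. (u, v) \<in> {(i, j). {i, j} \<in> G}\<^sup>*)"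

text \<open>The Ursell weight of the Mayer expansion. For a connected graph \<open>H\<close> on a
  finite set \<open>V\<close> it is, up to the sign (-1)^(|V|-1), the Tutte polynomial at
  (1,0).\<close>

definition mayer_sum :: "'a set \<Rightarrow> 'a set set \<Rightarrow> real" where
  "mayer_sum V H = (\<Sum>G\<in>Pow H. of_bool (spans V G) * (-1) ^ card G)"

text \<open>The enlarged edge relation lies between the old one and its reflexive transitive
  closure, so both have the same closure.\<close>

lemma spans_insert_chord:
  assumes "(u, w) \<in> {(i, j). {i, j} \<in> G}\<^sup>*"
  shows "spans V (insert {u, w} G) \<longleftrightarrow> spans V G"
proof -
  let ?E = "{(i, j). {i, j} \<in> G}"
  have "sym ?E"
    by (auto simp: sym_def insert_commute)
  then have "(w, u) \<in> ?E\<^sup>*"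
    using assms by (meson sym_rtrancl symD)
  then have "{(i, j). {i, j} \<in> insert {u, w} G} \<subseteq> ?E\<^sup>*"
    using assms by (auto simp: doubleton_eq_iff)
  moreover have "?E \<subseteq> {(i, j). {i, j} \<in> insert {u, w} G}"
    by auto
  ultimately have "{(i, j). {i, j} \<in> insert {u, w} G}\<^sup>* = ?E\<^sup>*"
    using rtrancl_subset by blast
  then show ?thesis
    by (simp add: spans_def)
qed

text \<open>Contracting the pendant edge onto \<open>u\<close> sends paths to paths and fixes the
  other vertices, so deleting \<open>v\<close> keeps them joined. Conversely, \<open>v\<close> is
  reached through \<open>u\<close>.\<close>

lemma spans_insert_leaf:
  assumes "v \<in> V" "u \<in> V" "u \<noteq> v" and "\<And>e. e \<in> G \<Longrightarrow> v \<notin> e"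
  shows "spans V (insert {u, v} G) \<longleftrightarrow> spans (V - {v}) G"
proof
  let ?E = "{(i, j). {i, j} \<in> G}" and ?E' = "{(i, j). {i, j} \<in> insert {u, v} G}"
  define \<pi> where "\<pi> a = (if a = v then u else a)" for a
  have edge: "(\<pi> a, \<pi> b) \<in> ?E\<^sup>*" if "(a, b) \<in> ?E'" for a b
  proof (cases "{a, b} = {u, v}")
    case True
    then have "\<pi> a = u" "\<pi> b = u"
      by (auto simp: \<pi>_def doubleton_eq_iff)
    then show ?thesis by simp
  next
    case False
    with that have "{a, b} \<in> G" by auto
    with assms(4) have "a \<noteq> v" "b \<noteq> v" by auto
    with \<open>{a, b} \<in> G\<close> show ?thesis by (auto simp: \<pi>_def)
  qed
  have path: "(\<pi> a, \<pi> b) \<in> ?E\<^sup>*" if "(a, b) \<in> ?E'\<^sup>*" for a b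
    using that
  proof induction
    case (step b c)
    then show ?case using edge[of b c] by (meson rtrancl_trans)
  qed simp
  show "spans (V - {v}) G" if "spans V (insert {u, v} G)"
    unfolding spans_def
  proof (intro ballI)
    fix a b assume "a \<in> V - {v}" "b \<in> V - {v}"
    moreover from this that have "(a, b) \<in> ?E'\<^sup>*"
      by (auto simp: spans_def)
    from path[OF this] show "(a, b) \<in> ?E\<^sup>*"
      using calculation by (simp add: \<pi>_def)
  qed
  show "spans V (insert {u, v} G)" if sp: "spans (V - {v}) G"
  proof -
    have mono: "?E\<^sup>* \<subseteq> ?E'\<^sup>*"
      by (rule rtrancl_mono) auto
    have uv: "(u, v) \<in> ?E'\<^sup>*" "(v, u) \<in> ?E'\<^sup>*"
      by (auto simp: insert_commute)
    \<comment> \<open>Every vertex is joined to the hub \<open>u\<close> in both directions, so any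
      two are joined through it.\<close>
    have u: "(a, u) \<in> ?E'\<^sup>*" "(u, a) \<in> ?E'\<^sup>*" if "a \<in> V" for a
      using sp mono uv that assms(2,3) by (cases "a = v"; force simp: spans_def)+
    show ?thesis
      unfolding spans_def using u by (meson rtrancl_trans)
  qed
qed

text \<open>A path from \<open>v\<close> to another vertex would have to start with an edge
  containing \<open>v\<close>.\<close>

lemma not_spans_isolated:
  assumes "v \<in> V" "V \<noteq> {v}" and "\<And>e. e \<in> G \<Longrightarrow> v \<notin> e"
  shows "\<not> spans V G"
proof
  assume sp: "spans V G"
  obtain a where "a \<in> V" "a \<noteq> v"
    using assms by auto
  with sp assms have "(v, a) \<in> {(i, j). {i, j} \<in> G}\<^sup>*"
    by (auto simp: spans_def)
  then show False
    using \<open>a \<noteq> v\<close> assms(3) by (cases rule: converse_rtranclE) auto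
qed

text \<open>Toggling \<open>e\<close> is an involution on the subsets of \<open>H\<close> that
  preserves \<open>h\<close> and flips the sign.\<close>

lemma alternating_sum_Pow_eq_0:
  fixes h :: "'a set \<Rightarrow> real"
  assumes "finite H" "e \<in> H" and "\<And>G. G \<subseteq> H \<Longrightarrow> h (insert e G) = h G"
  shows "(\<Sum>G\<in>Pow H. h G * (-1) ^ card G) = 0"
proof -
  define K where "K = H - {e}"
  have K: "H = insert e K" "e \<notin> K" "finite K"
    using assms by (auto simp: K_def)
  have "inj_on (insert e) (Pow K)"
    using K(2) by (auto simp: inj_on_def)
  then have "(\<Sum>G\<in>insert e ` Pow K. h G * (-1) ^ card G) = (\<Sum>G\<in>Pow K. h (insert e G) * (-1) ^ card (insert e G))"
    by (simp add: sum.reindex)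
  also have "\<dots> = (\<Sum>G\<in>Pow K. - (h G * (-1) ^ card G))"
  proof (rule sum.cong)
    fix G assume "G \<in> Pow K"
    then have "e \<notin> G" "finite G" "G \<subseteq> H"
      using K by (auto intro: finite_subset)
    then show "h (insert e G) * (-1) ^ card (insert e G) = - (h G * (-1) ^ card G)"
      using assms(3) by simp
  qed simp
  finally have "(\<Sum>G\<in>insert e ` Pow K. h G * (-1) ^ card G) = - (\<Sum>G\<in>Pow K. h G * (-1) ^ card G)"
    by (simp add: sum_negf)
  moreover have "Pow K \<inter> insert e ` Pow K = {}"
    using K(2) by auto
  ultimately show ?thesis
    using K(3) by (simp add: K(1) Pow_insert sum.union_disjoint)
qed

text \<open>Split a subgraph into the set \<open>S\<close> of its neighbours of \<open>v\<close> and the rest. If \<open>S\<close> contains two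
  vertices, the edge between them may be toggled without affecting connectedness, so only the
  singletons \<open>S\<close> contribute.\<close>

lemma mayer_sum_simplicial:
  assumes "finite V" "v \<in> V" "V \<noteq> {v}" and H: "\<And>e. e \<in> H \<Longrightarrow> e \<subseteq> V \<and> card e = 2"
    and clique: "\<And>u w. {u, v} \<in> H \<Longrightarrow> {w, v} \<in> H \<Longrightarrow> u \<noteq> w \<Longrightarrow> {u, w} \<in> H"
  shows "mayer_sum V H = - real (card {u. {u, v} \<in> H}) * mayer_sum (V - {v}) {e \<in> H. v \<notin> e}"
proof -
  define N where "N = {u. {u, v} \<in> H}"
  define H0 where "H0 = {e \<in> H. v \<notin> e}"
  define star where "star S = (\<lambda>u. {u, v}) ` S" for S
  have "v \<notin> N"
    using H by (force simp: N_def)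
  have "N \<subseteq> V"
    using H by (auto simp: N_def)
  then have [simp]: "finite N"
    using assms(1) finite_subset by blast
  have "H \<subseteq> Pow V" using H by auto
  then have "finite H"
    using assms(1) finite_subset by blast
  then have [simp]: "finite H0" by (simp add: H0_def)
  have edge_v: "\<exists>u\<in>N. e = {u, v}" if e: "e \<in> H" "v \<in> e" for e
  proof -
    obtain a b where "e = {a, b}" "a \<noteq> b"
      using H[OF e(1)] by (auto simp: card_2_iff)
    with e show ?thesis
      by (auto simp: N_def insert_commute)
  qed
  have inner_card: "card (star S \<union> G) = card S + card G" if "S \<in> Pow N" "G \<in> Pow H0" for S G
  proof -
    have "finite S" "finite G" using that by (auto intro: finite_subset)
    moreover have "card (star S) = card S"
      unfolding star_def by (rule card_image) (auto simp: inj_on_def doubleton_eq_iff)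
    moreover have "star S \<inter> G = {}"
      using that by (auto simp: star_def H0_def)
    ultimately show ?thesis
      by (simp add: card_Un_disjoint star_def)
  qed
  define inner where "inner S = (\<Sum>G\<in>Pow H0. of_bool (spans V (star S \<union> G)) * (-1::real) ^ card G)" for S
  have "mayer_sum V H = (\<Sum>(S, G)\<in>Pow N \<times> Pow H0. of_bool (spans V (star S \<union> G)) * (-1) ^ card (star S \<union> G))"
    unfolding mayer_sum_def
  \<comment> \<open>A subgraph corresponds to the pair of its neighbours of \<open>v\<close> and its
    edges avoiding \<open>v\<close>.\<close>
  proof (rule sum.reindex_bij_witness[where i = "\<lambda>(S, G). star S \<union> G" and j = "\<lambda>G. ({u \<in> N. {u, v} \<in> G}, {e \<in> G. v \<notin> e})"])
    fix G assume "G \<in> Pow H"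
    then have G: "G \<subseteq> H" by simp
    show eq: "(case ({u \<in> N. {u, v} \<in> G}, {e \<in> G. v \<notin> e}) of (S, G) \<Rightarrow> star S \<union> G) = G"
      using G edge_v by (fastforce simp: star_def)
    show "({u \<in> N. {u, v} \<in> G}, {e \<in> G. v \<notin> e}) \<in> Pow N \<times> Pow H0"
      using G by (auto simp: H0_def)
    show "(case ({u \<in> N. {u, v} \<in> G}, {e \<in> G. v \<notin> e}) of (S, G) \<Rightarrow>
        of_bool (spans V (star S \<union> G)) * (-1) ^ card (star S \<union> G)) = of_bool (spans V G) * (-1::real) ^ card G"
      using eq by simp
  next
    fix SG assume "SG \<in> Pow N \<times> Pow H0"
    then show "(\<lambda>G. ({u \<in> N. {u, v} \<in> G}, {e \<in> G. v \<notin> e})) (case SG of (S, G) \<Rightarrow> star S \<union> G) = SG"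
      by (auto simp: star_def H0_def doubleton_eq_iff)
    show "(case SG of (S, G) \<Rightarrow> star S \<union> G) \<in> Pow H"
      using \<open>SG \<in> Pow N \<times> Pow H0\<close> by (auto simp: star_def H0_def N_def)
  qed
  also have "\<dots> = (\<Sum>(S, G)\<in>Pow N \<times> Pow H0. (-1) ^ card S * (of_bool (spans V (star S \<union> G)) * (-1) ^ card G))"
    by (rule sum.cong) (auto simp: inner_card power_add)
  also have "\<dots> = (\<Sum>S\<in>Pow N. (-1) ^ card S * inner S)"
    by (simp only: sum.cartesian_product[symmetric] sum_distrib_left inner_def)
  also have "\<dots> = (\<Sum>S\<in>(\<lambda>u. {u}) ` N. (-1) ^ card S * inner S)"
  proof (rule sum.mono_neutral_right)
    show "\<forall>S\<in>Pow N - (\<lambda>u. {u}) ` N. (-1) ^ card S * inner S = 0"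
    proof
      fix S assume S: "S \<in> Pow N - (\<lambda>u. {u}) ` N"
      have "inner S = 0"
      proof (cases "S = {}")
        \<comment> \<open>Without neighbours \<open>v\<close> is isolated, although \<open>V\<close>
          has a further vertex.\<close>
        case True
        have "\<not> spans V G" if "G \<subseteq> H0" for G
          using that assms(2,3) by (intro not_spans_isolated) (auto simp: H0_def)
        then show ?thesis
          using True by (auto simp: inner_def star_def intro!: sum.neutral)
      next
        case False
        then obtain u where u: "u \<in> S" by auto
        with S obtain w where w: "w \<in> S" "w \<noteq> u"
          by blast
        have uw: "u \<in> N" "w \<in> N" using u w S by auto
        then have e: "{u, w} \<in> H0"
          using clique[of u w] w \<open>v \<notin> N\<close> by (auto simp: N_def H0_def)
        have "spans V (star S \<union> insert {u, w} G) \<longleftrightarrow> spans V (star S \<union> G)" for G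
        proof -
          \<comment> \<open>The detour over \<open>v\<close> already joins \<open>u\<close> and
            \<open>w\<close>, so the edge between them is a chord.\<close>
          have "(u, v) \<in> {(i, j). {i, j} \<in> star S \<union> G}\<^sup>*" "(v, w) \<in> {(i, j). {i, j} \<in> star S \<union> G}\<^sup>*"
            using u w by (auto simp: star_def insert_commute)
          then have "(u, w) \<in> {(i, j). {i, j} \<in> star S \<union> G}\<^sup>*"
            by (rule rtrancl_trans)
          from spans_insert_chord[OF this, of V] show ?thesis by simp
        qed
        then show ?thesis
          unfolding inner_def by (intro alternating_sum_Pow_eq_0[OF _ e]) auto
      qed
      then show "(-1) ^ card S * inner S = 0" by simp
    qed
  qed auto
  also have "\<dots> = (\<Sum>u\<in>N. - inner {u})"
    by (subst sum.reindex) auto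
  also have "\<dots> = (\<Sum>u\<in>N. - mayer_sum (V - {v}) H0)"
  proof (rule sum.cong)
    \<comment> \<open>With a single neighbour, \<open>v\<close> is a leaf and can be deleted; its
      one edge gives the minus sign.\<close>
    fix u assume "u \<in> N"
    then have "spans V (star {u} \<union> G) \<longleftrightarrow> spans (V - {v}) G" if "G \<in> Pow H0" for G
      using spans_insert_leaf[of v V u G] that assms(2) \<open>v \<notin> N\<close> \<open>N \<subseteq> V\<close>
      by (auto simp: star_def H0_def)
    then show "- inner {u} = - mayer_sum (V - {v}) H0"
      by (simp add: inner_def mayer_sum_def)
  qed simp
  finally show ?thesis
    by (simp add: N_def H0_def)
qed

section \<open>Unit interval graphs\<close>

text \<open>Ties are broken by the labels, so that the vertices are always totally ordered.\<close>

definition parent :: "(nat \<Rightarrow> real) \<Rightarrow> nat \<Rightarrow> nat \<Rightarrow> bool" where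
  "parent x i j \<longleftrightarrow> (x j < x i \<or> x j = x i \<and> j < i) \<and> x i \<le> x j + 1"

text \<open>Expanded, the product counts the maps that send every \<open>i\<close> in
  \<open>A\<close> to an admissible parent in \<open>V\<close>. Parents strictly precede their
  children in the order by position and label, so these maps have no cycles.\<close>

definition parent_choices :: "nat set \<Rightarrow> nat set \<Rightarrow> (nat \<Rightarrow> real) \<Rightarrow> nat" where
  "parent_choices V A x = (\<Prod>i\<in>A. \<Sum>j\<in>V. of_bool (parent x i j))"

definition unit_interval_graph :: "nat set \<Rightarrow> (nat \<Rightarrow> real) \<Rightarrow> nat set set" where
  "unit_interval_graph V x = {e. e \<subseteq> V \<and> card e = 2 \<and> (\<forall>i\<in>e. \<forall>j\<in>e. \<bar>x i - x j\<bar> \<le> 1)}"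

lemma lex_min_exists:
  fixes x :: "nat \<Rightarrow> real"
  assumes "finite V" "V \<noteq> {}"
  obtains v where "v \<in> V" "\<And>j. j \<in> V \<Longrightarrow> x v < x j \<or> x v = x j \<and> v \<le> j"
proof -
  define W where "W = {v \<in> V. x v = Min (x ` V)}"
  have "Min (x ` V) \<in> x ` V" using assms by simp
  then have "W \<noteq> {}" by (force simp: W_def)
  have W: "finite W" using assms by (simp add: W_def)
  have "Min W \<in> W" using W \<open>W \<noteq> {}\<close> by simp
  then have v: "Min W \<in> V" "x (Min W) = Min (x ` V)" by (simp_all add: W_def)
  show thesis
  proof (rule that[of "Min W"])
    fix j assume "j \<in> V"
    then have "x (Min W) \<le> x j" using v assms by simp
    moreover have "Min W \<le> j" if "x (Min W) = x j"
      using that \<open>j \<in> V\<close> v W by (intro Min_le) (auto simp: W_def)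
    ultimately show "x (Min W) < x j \<or> x (Min W) = x j \<and> Min W \<le> j" by fastforce
  qed (fact v)
qed

lemma lex_max_exists:
  fixes x :: "nat \<Rightarrow> real"
  assumes "finite V" "V \<noteq> {}"
  obtains v where "v \<in> V" "\<And>j. j \<in> V \<Longrightarrow> x j < x v \<or> x j = x v \<and> j \<le> v"
proof -
  define W where "W = {v \<in> V. x v = Max (x ` V)}"
  have "Max (x ` V) \<in> x ` V" using assms by simp
  then have "W \<noteq> {}" by (force simp: W_def)
  have W: "finite W" using assms by (simp add: W_def)
  have "Max W \<in> W" using W \<open>W \<noteq> {}\<close> by simp
  then have v: "Max W \<in> V" "x (Max W) = Max (x ` V)" by (simp_all add: W_def)
  show thesis
  proof (rule that[of "Max W"])
    fix j assume "j \<in> V"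
    then have "x j \<le> x (Max W)" using v assms by simp
    moreover have "j \<le> Max W" if "x j = x (Max W)"
      using that \<open>j \<in> V\<close> v W by (intro Max_ge) (auto simp: W_def)
    ultimately show "x j < x (Max W) \<or> x j = x (Max W) \<and> j \<le> Max W" by fastforce
  qed (fact v)
qed

text \<open>The first vertex in the order has no parent, so its factor vanishes.\<close>

lemma parent_choices_self_eq_0:
  assumes "finite V" "V \<noteq> {}"
  shows "parent_choices V V x = 0"
proof -
  obtain v where "v \<in> V" "\<And>j. j \<in> V \<Longrightarrow> x v < x j \<or> x v = x j \<and> v \<le> j"
    using lex_min_exists assms by blast
  then have "\<not> parent x v j" if "j \<in> V" for j
    using that by (fastforce simp: parent_def)
  then have "(\<Sum>j\<in>V. of_bool (parent x v j)) = (0::nat)" by simp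
  with \<open>v \<in> V\<close> assms show ?thesis
    by (auto simp: parent_choices_def)
qed

text \<open>Induction on the number of vertices, deleting the last vertex \<open>v\<close>. Its
  neighbours are exactly its possible parents, so both sides acquire the same factor. Only the
  leftmost root contributes on the right, but summing over all roots lets each one be integrated
  separately over all positions.\<close>

lemma mayer_sum_unit_interval_graph:
  assumes "finite V" "V \<noteq> {}"
  shows "mayer_sum V (unit_interval_graph V x) =
    (-1) ^ (card V - 1) * real (\<Sum>r\<in>V. parent_choices V (V - {r}) x)"
  using assms
proof (induction "card V" arbitrary: V)
  case (Suc m)
  obtain v where v: "v \<in> V" "\<And>j. j \<in> V \<Longrightarrow> x j < x v \<or> x j = x v \<and> j \<le> v"
    using lex_max_exists Suc.prems by blast
  define W where "W = V - {v}"
  have W: "finite W" "card W = m" "V = insert v W" "v \<notin> W"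
    using Suc v by (auto simp: W_def)
  let ?H = "unit_interval_graph V x"
  show ?case
  proof (cases "W = {}")
    case True
    then have V: "V = {v}" using W by simp
    have "e \<notin> ?H" for e
    proof
      assume "e \<in> ?H"
      then have "e \<subseteq> {v}" "card e = 2" by (auto simp: unit_interval_graph_def V)
      then show False using card_mono[of "{v}" e] by simp
    qed
    then have "?H = {}" by blast
    then show ?thesis
      by (simp add: V mayer_sum_def spans_def parent_choices_def)
  next
    case False
    have nb: "{u. {u, v} \<in> ?H} = {j \<in> V. parent x v j}"
    proof (intro set_eqI iffI; clarify)
      fix u assume u: "{u, v} \<in> ?H"
      then have "u \<in> V" "u \<noteq> v" "\<bar>x u - x v\<bar> \<le> 1" by (auto simp: unit_interval_graph_def)
      then show "u \<in> V \<and> parent x v u" using v(2)[of u] by (auto simp: parent_def)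
    next
      fix u assume "u \<in> V" "parent x v u"
      then show "{u, v} \<in> ?H"
        using v(1) by (auto simp: parent_def unit_interval_graph_def card_2_iff)
    qed
    \<comment> \<open>All neighbours of \<open>v\<close> lie in an interval of length 1 ending at
      \<open>x v\<close>, hence form a clique.\<close>
    have "mayer_sum V ?H = - real (card {u. {u, v} \<in> ?H}) * mayer_sum (V - {v}) {e \<in> ?H. v \<notin> e}"
    proof (rule mayer_sum_simplicial)
      show "{u, w} \<in> ?H" if "{u, v} \<in> ?H" "{w, v} \<in> ?H" "u \<noteq> w" for u w
      proof -
        from that(1,2) have "u \<in> V" "w \<in> V" "parent x v u" "parent x v w" using nb by auto
        with \<open>u \<noteq> w\<close> show ?thesis
          by (auto simp: unit_interval_graph_def parent_def)
      qed
    qed (use Suc.prems v False W in \<open>auto simp: unit_interval_graph_def\<close>)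
    also have "V - {v} = W" using W by auto
    also have "{e \<in> ?H. v \<notin> e} = unit_interval_graph W x"
      using W by (auto simp: unit_interval_graph_def)
    also have "card {u. {u, v} \<in> ?H} = (\<Sum>j\<in>V. of_bool (parent x v j))"
      unfolding nb using Suc.prems(1) by (simp add: Int_def)
    also have "mayer_sum W (unit_interval_graph W x) = (-1) ^ (card W - 1) * real (\<Sum>r\<in>W. parent_choices W (W - {r}) x)"
      using Suc.hyps(1)[of W] W False by blast
    finally have 1: "mayer_sum V ?H = - real (\<Sum>j\<in>V. of_bool (parent x v j)) *
        ((-1) ^ (card W - 1) * real (\<Sum>r\<in>W. parent_choices W (W - {r}) x))" .
    have no: "\<not> parent x i v" if "i \<in> V" for i
      using v(2)[OF that] unfolding parent_def by linarith
    have drop: "(\<Sum>j\<in>V. of_bool (parent x i j)) = (\<Sum>j\<in>W. of_bool (parent x i j) :: nat)" if "i \<in> W" for i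
      using no[of i] that W(1,4) by (simp add: W(3))
    have "parent_choices V (V - {r}) x = (\<Sum>j\<in>V. of_bool (parent x v j)) * parent_choices W (W - {r}) x" if "r \<in> W" for r
    proof -
      have "V - {r} = insert v (W - {r})" using W that by auto
      then show ?thesis
        using W drop unfolding parent_choices_def by simp
    qed
    \<comment> \<open>If \<open>v\<close> were the root, all of \<open>W\<close> would need parents
      inside \<open>W\<close>.\<close>
    moreover have "parent_choices V (V - {v}) x = 0"
    proof -
      have "V - {v} = W" using W by auto
      then have "parent_choices V (V - {v}) x = parent_choices W W x"
        using drop by (simp add: parent_choices_def)
      then show ?thesis using parent_choices_self_eq_0 W False by simp
    qed
    ultimately have "(\<Sum>r\<in>V. parent_choices V (V - {r}) x) =
        (\<Sum>j\<in>V. of_bool (parent x v j)) * (\<Sum>r\<in>W. parent_choices W (W - {r}) x)"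
      using W by (subst (1) W(3)) (simp add: sum_distrib_left)
    moreover have "card V - 1 = Suc (card W - 1)"
      using W False Suc.hyps(2) by (metis Suc_pred' card_gt_0_iff diff_Suc_1)
    ultimately show ?thesis
      using 1 by simp
  qed
qed simp

lemma parent_choices_cong:
  assumes "\<And>i. i \<in> V \<union> A \<Longrightarrow> x i = y i"
  shows "parent_choices V A x = parent_choices V A y"
  unfolding parent_choices_def parent_def using assms by (intro prod.cong sum.cong) auto

lemma parent_choices_translate: "parent_choices V A (\<lambda>i. x i + c) = parent_choices V A x"
proof -
  have "parent (\<lambda>i. x i + c) i j = parent x i j" for i j
    unfolding parent_def by auto
  then show ?thesis
    unfolding parent_choices_def by simp
qed

text \<open>\<open>S\<close> is the set of vertices that choose their parent in \<open>R\<close>;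
  the others choose it in \<open>A\<close>. The remaining problem has the same shape, with
  \<open>S\<close> as the new roots. The empty \<open>S\<close> drops out because \<open>A\<close>
  cannot supply parents for all of itself.\<close>

lemma parent_choices_layers:
  assumes "finite A" "finite R" "A \<inter> R = {}" "A \<noteq> {}"
  shows "parent_choices (A \<union> R) A x =
    (\<Sum>S\<in>Pow A - {{}}. parent_choices R S x * parent_choices A (A - S) x)"
proof -
  have "parent_choices (A \<union> R) A x =
      (\<Prod>i\<in>A. (\<Sum>j\<in>R. of_bool (parent x i j)) + (\<Sum>j\<in>A. of_bool (parent x i j)))"
    unfolding parent_choices_def using assms by (simp add: sum.union_disjoint add.commute del: sum_of_bool_eq)
  also have "\<dots> = (\<Sum>S\<in>Pow A. parent_choices R S x * parent_choices A (A - S) x)"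
    unfolding parent_choices_def using assms(1) by (rule prod_add)
  also have "\<dots> = (\<Sum>S\<in>Pow A - {{}}. parent_choices R S x * parent_choices A (A - S) x)"
    using assms(1) parent_choices_self_eq_0[OF assms(1,4), of x]
    by (intro sum.mono_neutral_right) auto
  finally show ?thesis .
qed

section \<open>Counting forests by their first layer\<close>

text \<open>The number of forests on \<open>m + k\<close> labelled vertices with \<open>k\<close> prescribed roots.\<close>

definition forest_count :: "nat \<Rightarrow> nat \<Rightarrow> nat" where
  "forest_count m k = (if m = 0 then 1 else k * (k + m) ^ (m - 1))"

lemma sum_Pow_card:
  fixes f :: "nat \<Rightarrow> nat"
  assumes "finite A"
  shows "(\<Sum>S\<in>Pow A. f (card S)) = (\<Sum>s\<le>card A. (card A choose s) * f s)"
proof -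
  have "(\<Sum>S\<in>Pow A. f (card S)) = (\<Sum>s\<le>card A. \<Sum>S | S \<in> Pow A \<and> card S = s. f (card S))"
    using assms by (intro sum.group[symmetric]) (auto intro: card_mono)
  also have "\<dots> = (\<Sum>s\<le>card A. (card A choose s) * f s)"
    using assms by (intro sum.cong) (auto simp: n_subsets)
  finally show ?thesis .
qed

text \<open>Classify forests by the set \<open>S\<close> of children of the roots. The proof
  multiplies by the number m of vertices in \<open>A\<close> and uses s * binom(m, s) = m *
  binom(m-1, s-1), which leaves the binomial expansion of (k+m)^(m-1).\<close>

lemma forest_count_layers:
  assumes "finite A" "A \<noteq> {}"
  shows "(\<Sum>S\<in>Pow A - {{}}. k ^ card S * forest_count (card A - card S) (card S)) =
    forest_count (card A) k"
proof -
  obtain p where p: "card A = Suc p"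
    using assms by (metis card_gt_0_iff gr0_implies_Suc)
  let ?m = "card A"
  \<comment> \<open>The factor \<open>?m\<close> absorbs the truncated exponent of
    \<open>forest_count\<close>; at s = m, where \<open>forest_count\<close> is 1 by definition,
    both sides equal m.\<close>
  have T: "?m * forest_count (?m - s) s = s * ?m ^ (?m - s)" if "s \<le> ?m" "s > 0" for s
  proof (cases "s = ?m")
    case False
    with that have "?m - s = Suc (?m - s - 1)" "s + (?m - s) = ?m" by auto
    then show ?thesis
      using False that by (simp add: forest_count_def mult.left_commute flip: power_Suc)
  qed (simp add: forest_count_def)
  have "?m * (\<Sum>S\<in>Pow A - {{}}. k ^ card S * forest_count (?m - card S) (card S)) =
      (\<Sum>S\<in>Pow A - {{}}. k ^ card S * (card S * ?m ^ (?m - card S)))"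
    unfolding sum_distrib_left
  proof (rule sum.cong)
    fix S assume S: "S \<in> Pow A - {{}}"
    then have "card S \<le> ?m" "card S > 0"
      using assms by (auto intro: card_mono finite_subset simp: card_gt_0_iff)
    then show "?m * (k ^ card S * forest_count (?m - card S) (card S)) = k ^ card S * (card S * ?m ^ (?m - card S))"
      using T[of "card S"] by (metis mult.left_commute)
  qed simp
  \<comment> \<open>The factor \<open>card S\<close> vanishes on the empty set, which may therefore
    be put back.\<close>
  also have "\<dots> = (\<Sum>S\<in>Pow A. k ^ card S * (card S * ?m ^ (?m - card S)))"
    using assms by (intro sum.mono_neutral_left) auto
  also have "\<dots> = (\<Sum>s\<le>?m. (?m choose s) * (k ^ s * (s * ?m ^ (?m - s))))"
    using assms by (intro sum_Pow_card) auto
  also have "\<dots> = (\<Sum>s\<le>p. (Suc p choose Suc s) * (k ^ Suc s * (Suc s * Suc p ^ (p - s))))"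
    unfolding p by (subst sum.atMost_Suc_shift) simp
  also have "\<dots> = (\<Sum>s\<le>p. Suc p * k * ((p choose s) * k ^ s * Suc p ^ (p - s)))"
  proof (rule sum.cong)
    fix s
    have "(Suc p choose Suc s) * (k ^ Suc s * (Suc s * Suc p ^ (p - s))) =
        ((Suc p choose Suc s) * Suc s) * (k ^ Suc s * Suc p ^ (p - s))"
      by (simp only: mult_ac)
    also have "\<dots> = (Suc p * (p choose s)) * (k ^ Suc s * Suc p ^ (p - s))"
      by (simp only: Suc_times_binomial_eq)
    finally show "(Suc p choose Suc s) * (k ^ Suc s * (Suc s * Suc p ^ (p - s))) = Suc p * k * ((p choose s) * k ^ s * Suc p ^ (p - s))"
      by (simp only: mult_ac power_Suc)
  qed simp
  also have "\<dots> = Suc p * k * (k + Suc p) ^ p"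
    by (subst binomial) (simp add: sum_distrib_left)
  also have "\<dots> = ?m * forest_count ?m k"
    by (simp add: p forest_count_def algebra_simps)
  finally have "?m * (\<Sum>S\<in>Pow A - {{}}. k ^ card S * forest_count (?m - card S) (card S)) =
      ?m * forest_count ?m k" .
  moreover have "?m \<noteq> 0" using p by simp
  ultimately show ?thesis
    by (subst (asm) mult_left_cancel)
qed

section \<open>Integration over forests\<close>

text \<open>The point is a function \<open>f w\<close> of the integration variable, so that updates,
  overrides and pairs of partial points are all covered.\<close>

lemma measurable_parent_choices:
  assumes "\<And>i. i \<in> V \<union> A \<Longrightarrow> (\<lambda>w. f w i) \<in> borel_measurable M"
  shows "(\<lambda>w. of_nat (parent_choices V A (f w)) :: ennreal) \<in> borel_measurable M"
proof -
  have meas: "(\<lambda>w. of_bool (parent (f w) i j) :: ennreal) \<in> borel_measurable M" if "i \<in> A" "j \<in> V" for i j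
  proof -
    have [measurable]: "(\<lambda>w. f w i) \<in> borel_measurable M" "(\<lambda>w. f w j) \<in> borel_measurable M"
      using assms that by auto
    have "Measurable.pred M (\<lambda>w. parent (f w) i j)"
      unfolding parent_def by measurable
    then show ?thesis
      unfolding of_bool_def by measurable
  qed
  show ?thesis
    unfolding parent_choices_def of_nat_prod of_nat_sum of_nat_of_bool
    by (intro borel_measurable_prod_ennreal borel_measurable_sum meas)
qed

text \<open>The roots are frozen at the values in \<open>y\<close>, so the integrand is a product of
  functions of single coordinates. Each factor integrates to the number of roots, since every root
  offers an interval of length 1.\<close>

lemma nn_integral_parent_choices_independent:
  assumes "finite A" "finite R" "A \<inter> R = {}"
  shows "(\<integral>\<^sup>+x. of_nat (parent_choices R A (override_on y x A)) \<partial>Pi\<^sub>M A (\<lambda>_. lborel)) =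
    of_nat (card R ^ card A)"
proof -
  interpret product_sigma_finite "\<lambda>_::nat. lborel :: real measure" ..
  \<comment> \<open>The admissible positions of \<open>i\<close> when its parent is
    \<open>j\<close>. The tie-break only decides whether the left end belongs, so the length is 1
    either way.\<close>
  define I where "I i j = (if j < i then {y j..y j + 1} else {y j<..y j + 1})" for i j :: nat
  have "(\<integral>\<^sup>+x. of_nat (parent_choices R A (override_on y x A)) \<partial>Pi\<^sub>M A (\<lambda>_. lborel)) =
      (\<integral>\<^sup>+x. (\<Prod>i\<in>A. \<Sum>j\<in>R. indicator (I i j) (x i)) \<partial>Pi\<^sub>M A (\<lambda>_. lborel))"
  proof (rule nn_integral_cong)
    fix x
    have "(of_bool (parent (override_on y x A) i j) :: ennreal) = indicator (I i j) (x i)" if "i \<in> A" "j \<in> R" for i j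
    proof -
      have "j \<notin> A" using that assms by auto
      then show ?thesis
        using that by (auto simp: parent_def I_def override_on_def indicator_def)
    qed
    then show "of_nat (parent_choices R A (override_on y x A)) = (\<Prod>i\<in>A. \<Sum>j\<in>R. indicator (I i j) (x i) :: ennreal)"
      by (simp add: parent_choices_def)
  qed
  also have "\<dots> = (\<Prod>i\<in>A. \<integral>\<^sup>+t. (\<Sum>j\<in>R. indicator (I i j) t) \<partial>lborel)"
    by (rule product_nn_integral_prod) (use assms in \<open>auto simp: I_def\<close>)
  also have "\<dots> = (\<Prod>i\<in>A. of_nat (card R))"
  proof (rule prod.cong)
    fix i
    have "(\<integral>\<^sup>+t. (\<Sum>j\<in>R. indicator (I i j) t) \<partial>lborel) = (\<Sum>j\<in>R. \<integral>\<^sup>+t. indicator (I i j) t \<partial>lborel)"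
      by (rule nn_integral_sum) (auto simp: I_def)
    also have "\<dots> = (\<Sum>j\<in>R. 1)"
      by (rule sum.cong) (auto simp: I_def)
    finally show "(\<integral>\<^sup>+t. (\<Sum>j\<in>R. indicator (I i j) t) \<partial>lborel) = of_nat (card R)"
      by simp
  qed simp
  finally show ?thesis by simp
qed

text \<open>Expanding the product gives a sum over forests on \<open>A\<close> with roots \<open>R\<close>, each of volume 1. The
  induction peels off the layer \<open>S\<close> of the children of the roots, so the forests themselves never
  appear.\<close>

lemma nn_integral_parent_choices:
  assumes "finite A" "finite R" "A \<inter> R = {}"
  shows "(\<integral>\<^sup>+x. of_nat (parent_choices (A \<union> R) A (override_on y x A)) \<partial>Pi\<^sub>M A (\<lambda>_. lborel)) =
    of_nat (forest_count (card A) (card R))"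
  using assms
proof (induction "card A" arbitrary: A R y rule: less_induct)
  case less
  interpret product_sigma_finite "\<lambda>_::nat. lborel :: real measure" ..
  let ?L = "\<lambda>_::nat. lborel :: real measure"
  show ?case
  proof (cases "A = {}")
    case True
    then show ?thesis
      by (simp add: parent_choices_def forest_count_def PiM_empty space_PiM)
  next
    case False
    have comp: "(\<lambda>x. override_on y x A i) \<in> borel_measurable (Pi\<^sub>M A ?L)" for y A i
      by (cases "i \<in> A") simp_all
    have layer: "(\<integral>\<^sup>+x. of_nat (parent_choices R S (override_on y x A)) *
        of_nat (parent_choices A (A - S) (override_on y x A)) \<partial>Pi\<^sub>M A ?L) =
        of_nat (card R ^ card S * forest_count (card A - card S) (card S))"
      if S: "S \<in> Pow A - {{}}" for S
    proof -
      \<comment> \<open>By Fubini the coordinates in \<open>B\<close> are integrated first. Those in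
        \<open>S\<close> are then frozen and act as roots, so the induction hypothesis applies to
        \<open>B\<close> with a modified \<open>y\<close>, and its value does not depend on where
        \<open>S\<close> lies. The integral over \<open>S\<close> sees only
        \<open>R\<close>.\<close>
      define B where "B = A - S"
      have AB: "S \<union> B = A" "S \<inter> B = {}" "finite S" "finite B"
        using S less.prems finite_subset by (auto simp: B_def)
      have cardB: "card B = card A - card S"
        using S AB(3) by (simp add: B_def card_Diff_subset)
      have "B \<subset> A"
        using S by (auto simp: B_def)
      then have card_less: "card B < card A"
        using less.prems(1) by (intro psubset_card_mono)
      let ?f = "\<lambda>x. of_nat (parent_choices R S (override_on y x A)) * of_nat (parent_choices A B (override_on y x A)) :: ennreal"
      have meas: "?f \<in> borel_measurable (Pi\<^sub>M A ?L)"
        by (intro borel_measurable_times_ennreal measurable_parent_choices comp)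
      have "(\<integral>\<^sup>+x. ?f x \<partial>Pi\<^sub>M A ?L) = (\<integral>\<^sup>+x. \<integral>\<^sup>+z. ?f (merge S B (x, z)) \<partial>Pi\<^sub>M B ?L \<partial>Pi\<^sub>M S ?L)"
        using product_nn_integral_fold[of S B ?f] AB meas by simp
      also have "\<dots> = (\<integral>\<^sup>+x. of_nat (parent_choices R S (override_on y x S)) * of_nat (forest_count (card B) (card S)) \<partial>Pi\<^sub>M S ?L)"
      proof (rule nn_integral_cong)
        fix x :: "nat \<Rightarrow> real"
        have 1: "parent_choices R S (override_on y (merge S B (x, z)) A) = parent_choices R S (override_on y x S)" for z
          using AB less.prems by (intro parent_choices_cong) (auto simp: override_on_def merge_def)
        have 2: "parent_choices A B (override_on y (merge S B (x, z)) A) = parent_choices (B \<union> S) B (override_on (override_on y x S) z B)" for z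
        proof -
          have "B \<union> S = A" using AB by auto
          moreover have "parent_choices A B (override_on y (merge S B (x, z)) A) = parent_choices A B (override_on (override_on y x S) z B)"
            using AB by (intro parent_choices_cong) (auto simp: override_on_def merge_def)
          ultimately show ?thesis by simp
        qed
        have "(\<integral>\<^sup>+z. ?f (merge S B (x, z)) \<partial>Pi\<^sub>M B ?L) = of_nat (parent_choices R S (override_on y x S)) *
            (\<integral>\<^sup>+z. of_nat (parent_choices (B \<union> S) B (override_on (override_on y x S) z B)) \<partial>Pi\<^sub>M B ?L)"
          unfolding 1 2 by (intro nn_integral_cmult measurable_parent_choices comp)
        also have "(\<integral>\<^sup>+z. of_nat (parent_choices (B \<union> S) B (override_on (override_on y x S) z B)) \<partial>Pi\<^sub>M B ?L) =
            of_nat (forest_count (card B) (card S))"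
          using less.hyps[OF card_less] AB by (simp add: Int_commute)
        finally show "(\<integral>\<^sup>+z. ?f (merge S B (x, z)) \<partial>Pi\<^sub>M B ?L) =
            of_nat (parent_choices R S (override_on y x S)) * of_nat (forest_count (card B) (card S))" .
      qed
      also have "\<dots> = (\<integral>\<^sup>+x. of_nat (parent_choices R S (override_on y x S)) \<partial>Pi\<^sub>M S ?L) * of_nat (forest_count (card B) (card S))"
        by (intro nn_integral_multc measurable_parent_choices comp)
      also have "(\<integral>\<^sup>+x. of_nat (parent_choices R S (override_on y x S)) \<partial>Pi\<^sub>M S ?L) = of_nat (card R ^ card S)"
        using AB S less.prems by (intro nn_integral_parent_choices_independent) auto
      finally show ?thesis
        by (simp add: B_def cardB[unfolded B_def])
    qed
    have "(\<integral>\<^sup>+x. of_nat (parent_choices (A \<union> R) A (override_on y x A)) \<partial>Pi\<^sub>M A ?L) =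
        (\<integral>\<^sup>+x. (\<Sum>S\<in>Pow A - {{}}. of_nat (parent_choices R S (override_on y x A)) *
          of_nat (parent_choices A (A - S) (override_on y x A))) \<partial>Pi\<^sub>M A ?L)"
      using less.prems False by (simp add: parent_choices_layers)
    also have "\<dots> = (\<Sum>S\<in>Pow A - {{}}. \<integral>\<^sup>+x. of_nat (parent_choices R S (override_on y x A)) *
          of_nat (parent_choices A (A - S) (override_on y x A)) \<partial>Pi\<^sub>M A ?L)"
      by (intro nn_integral_sum borel_measurable_times_ennreal measurable_parent_choices comp)
    also have "\<dots> = of_nat (\<Sum>S\<in>Pow A - {{}}. card R ^ card S * forest_count (card A - card S) (card S))"
      unfolding of_nat_sum by (rule sum.cong[OF refl layer])
    also have "\<dots> = of_nat (forest_count (card A) (card R))"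
      by (simp only: forest_count_layers[OF less.prems(1) False])
    finally show ?thesis .
  qed
qed

section \<open>Moving the origin to the root\<close>

text \<open>The image measure agrees with the product measure on boxes, because
  \<open>lborel\<close> is translation invariant in each coordinate.\<close>

lemma nn_integral_PiM_lborel_translate:
  fixes c :: real
  assumes "finite J" and "f \<in> borel_measurable (Pi\<^sub>M J (\<lambda>_. lborel))"
  shows "(\<integral>\<^sup>+x. f (\<lambda>i\<in>J. x i + c) \<partial>Pi\<^sub>M J (\<lambda>_. lborel)) = (\<integral>\<^sup>+x. f x \<partial>Pi\<^sub>M J (\<lambda>_. lborel))"
proof -
  interpret product_sigma_finite "\<lambda>_. lborel :: real measure" ..
  let ?M = "Pi\<^sub>M J (\<lambda>_. lborel :: real measure)" and ?T = "\<lambda>x. \<lambda>i\<in>J. x i + c"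
  have T[measurable]: "?T \<in> measurable ?M ?M"
    by (intro measurable_restrict) auto
  have "distr ?M ?M ?T = ?M"
  proof (rule PiM_eqI)
    fix A :: "'a \<Rightarrow> real set" assume A: "\<And>i. i \<in> J \<Longrightarrow> A i \<in> sets lborel"
    have "emeasure (distr ?M ?M ?T) (Pi\<^sub>E J A) = emeasure ?M (?T -` Pi\<^sub>E J A \<inter> space ?M)"
      using assms(1) A by (intro emeasure_distr T sets_PiM_I_finite) auto
    also have "?T -` Pi\<^sub>E J A \<inter> space ?M = Pi\<^sub>E J (\<lambda>i. (+) c -` A i)"
      by (auto simp: space_PiM PiE_iff add.commute)
    also have "emeasure ?M \<dots> = (\<Prod>i\<in>J. emeasure lborel ((+) c -` A i))"
      using assms(1) A by (intro emeasure_PiM) (auto intro!: measurable_sets_borel[of "(+) c" borel])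
    also have "\<dots> = (\<Prod>i\<in>J. emeasure lborel (A i))"
    proof (rule prod.cong)
      fix i assume "i \<in> J"
      then have "A i \<in> sets borel" using A by simp
      then have "emeasure lborel ((+) c -` A i) = emeasure (distr lborel borel ((+) c)) (A i)"
        by (subst emeasure_distr) auto
      then show "emeasure lborel ((+) c -` A i) = emeasure lborel (A i)"
        by (simp add: lborel_distr_plus)
    qed simp
    finally show "emeasure (distr ?M ?M ?T) (Pi\<^sub>E J A) = (\<Prod>i\<in>J. emeasure lborel (A i))" .
  qed (use assms in auto)
  then have "(\<integral>\<^sup>+x. f x \<partial>?M) = (\<integral>\<^sup>+x. f x \<partial>distr ?M ?M ?T)"
    by simp
  also have "\<dots> = (\<integral>\<^sup>+x. f (?T x) \<partial>?M)"
    using assms(2) by (intro nn_integral_distr T) simp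
  finally show ?thesis by simp
qed

text \<open>If \<open>r\<close> sits at the origin, this is the forest integral with the single root
  \<open>r\<close>. The convention pins vertex 0 instead; translating all points by minus the
  position of \<open>r\<close> exchanges the two normalizations and preserves volume.\<close>

lemma nn_integral_parent_choices_root:
  assumes "r \<le> n"
  shows "(\<integral>\<^sup>+x. of_nat (parent_choices {0..n} ({0..n} - {r}) (x(0 := 0))) \<partial>Pi\<^sub>M {1..n} (\<lambda>_. lborel)) =
    of_nat (forest_count n 1)"
proof -
  interpret product_sigma_finite "\<lambda>_::nat. lborel :: real measure" ..
  let ?L = "\<lambda>_::nat. lborel :: real measure"
  let ?F = "\<lambda>w. of_nat (parent_choices {0..n} ({0..n} - {r}) w) :: ennreal"
  have root: "(\<integral>\<^sup>+x. ?F (x(r := 0)) \<partial>Pi\<^sub>M ({0..n} - {r}) ?L) = of_nat (forest_count n 1)"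
  proof -
    have "(\<integral>\<^sup>+x. ?F (x(r := 0)) \<partial>Pi\<^sub>M ({0..n} - {r}) ?L) =
        (\<integral>\<^sup>+x. of_nat (parent_choices (({0..n} - {r}) \<union> {r}) ({0..n} - {r})
          (override_on (\<lambda>_. 0) x ({0..n} - {r}))) \<partial>Pi\<^sub>M ({0..n} - {r}) ?L)"
    proof (rule nn_integral_cong)
      fix x :: "nat \<Rightarrow> real"
      have "({0..n} - {r}) \<union> {r} = {0..n}" using assms by auto
      moreover have "parent_choices {0..n} ({0..n} - {r}) (x(r := 0)) =
          parent_choices {0..n} ({0..n} - {r}) (override_on (\<lambda>_. 0) x ({0..n} - {r}))"
        by (rule parent_choices_cong) (auto simp: override_on_def)
      ultimately show "?F (x(r := 0)) = of_nat (parent_choices (({0..n} - {r}) \<union> {r}) ({0..n} - {r})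
          (override_on (\<lambda>_. 0) x ({0..n} - {r})))"
        by simp
    qed
    also have "\<dots> = of_nat (forest_count (card ({0..n} - {r})) (card {r}))"
      by (rule nn_integral_parent_choices) auto
    also have "\<dots> = of_nat (forest_count n 1)"
      using assms by simp
    finally show ?thesis .
  qed
  show ?thesis
  proof (cases "r = 0")
    case True
    have "{0..n} - {0} = {1..n}" by auto
    then show ?thesis using root by (simp only: True)
  next
    case False
    define B where "B = {1..n} - {r}"
    have B: "finite B" "r \<notin> B" "0 \<notin> B" "{1..n} = insert r B" "{0..n} - {r} = insert 0 B"
      using False assms by (auto simp: B_def)
    have "{0..n} = insert 0 {1..n}" by auto
    then have V: "{0..n} = insert 0 (insert r B)" by (simp only: B(4))
    have "(\<integral>\<^sup>+x. ?F (x(0 := 0)) \<partial>Pi\<^sub>M {1..n} ?L) = (\<integral>\<^sup>+t. \<integral>\<^sup>+z. ?F (z(r := t, 0 := 0)) \<partial>Pi\<^sub>M B ?L \<partial>lborel)"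
      unfolding B(4)
    proof (rule product_nn_integral_insert_rev[OF B(1,2)])
      show "(\<lambda>x. of_nat (parent_choices {0..n} ({0..n} - {r}) (x(0 := 0))) :: ennreal) \<in> borel_measurable (Pi\<^sub>M (insert r B) ?L)"
        unfolding V by (rule measurable_parent_choices) (auto simp: fun_upd_def)
    qed
    also have "\<dots> = (\<integral>\<^sup>+t. \<integral>\<^sup>+z. ?F (z(0 := - t, r := 0)) \<partial>Pi\<^sub>M B ?L \<partial>lborel)"
    proof (rule nn_integral_cong)
      \<comment> \<open>After \<open>z\<close> is shifted by \<open>t\<close>, the positions of 0,
        \<open>r\<close> and \<open>i\<close> are 0, t and z i + t. This is the configuration -t, 0,
        z i translated by \<open>t\<close>, and only differences of positions matter.\<close>
      fix t :: real
      have "(\<integral>\<^sup>+z. ?F (z(r := t, 0 := 0)) \<partial>Pi\<^sub>M B ?L) =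
          (\<integral>\<^sup>+z. ?F ((\<lambda>i\<in>B. z i + t)(r := t, 0 := 0)) \<partial>Pi\<^sub>M B ?L)"
      proof (rule nn_integral_PiM_lborel_translate[symmetric, OF B(1)])
        have "(\<lambda>z. (z(r := t, 0 := 0)) i) \<in> borel_measurable (Pi\<^sub>M B ?L)" if "i \<in> insert 0 (insert r B)" for i
          using that by (cases "i = 0"; cases "i = r") auto
        then show "(\<lambda>z. ?F (z(r := t, 0 := 0))) \<in> borel_measurable (Pi\<^sub>M B ?L)"
          unfolding V by (intro measurable_parent_choices) auto
      qed
      also have "\<dots> = (\<integral>\<^sup>+z. ?F (\<lambda>i. (z(0 := - t, r := 0)) i + t) \<partial>Pi\<^sub>M B ?L)"
        unfolding V using B False
        by (intro nn_integral_cong arg_cong[where f = of_nat] parent_choices_cong) auto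
      finally show "(\<integral>\<^sup>+z. ?F (z(r := t, 0 := 0)) \<partial>Pi\<^sub>M B ?L) = (\<integral>\<^sup>+z. ?F (z(0 := - t, r := 0)) \<partial>Pi\<^sub>M B ?L)"
        by (simp only: parent_choices_translate)
    qed
    also have "\<dots> = (\<integral>\<^sup>+t. \<integral>\<^sup>+z. ?F (z(0 := t, r := 0)) \<partial>Pi\<^sub>M B ?L \<partial>lborel)"
    proof -
      interpret finite_product_sigma_finite ?L B by standard (fact B(1))
      have "(\<lambda>p. ?F ((snd p)(0 := fst p, r := 0))) \<in> borel_measurable (lborel \<Otimes>\<^sub>M Pi\<^sub>M B ?L)"
      proof (rule measurable_parent_choices)
        fix i assume "i \<in> {0..n} \<union> ({0..n} - {r})"
        then have "i = 0 \<or> i = r \<or> i \<in> B" using V by auto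
        then consider "i = r" | "i = 0" "i \<noteq> r" | "i \<in> B" "i \<noteq> 0" "i \<noteq> r" using B False by blast
        then show "(\<lambda>p. ((snd p)(0 := fst p, r := 0)) i) \<in> borel_measurable (lborel \<Otimes>\<^sub>M Pi\<^sub>M B ?L)"
          by cases auto
      qed
      then have "(\<lambda>t. \<integral>\<^sup>+z. ?F (z(0 := t, r := 0)) \<partial>Pi\<^sub>M B ?L) \<in> borel_measurable lborel"
        by (intro borel_measurable_nn_integral) (simp add: case_prod_unfold)
      then show ?thesis
        \<comment> \<open>The reflection of \<open>t\<close>, with slope -1, preserves Lebesgue
          measure.\<close>
        using nn_integral_real_affine[of "\<lambda>t. \<integral>\<^sup>+z. ?F (z(0 := t, r := 0)) \<partial>Pi\<^sub>M B ?L" "-1" 0] by simp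
    qed
    also have "\<dots> = (\<integral>\<^sup>+x. ?F (x(r := 0)) \<partial>Pi\<^sub>M (insert 0 B) ?L)"
    proof (rule product_nn_integral_insert_rev[symmetric, OF B(1,3)])
      show "(\<lambda>x. ?F (x(r := 0))) \<in> borel_measurable (Pi\<^sub>M (insert 0 B) ?L)"
        unfolding V by (rule measurable_parent_choices) (auto simp: fun_upd_def)
    qed
    also have "\<dots> = of_nat (forest_count n 1)"
      using root by (simp add: B(5))
    finally show ?thesis .
  qed
qed

section \<open>Graph polytopes\<close>

text \<open>Along a path from 0 each edge raises the bound on the coordinate by 1. Connectedness
  thus puts the polytope in a box, which makes its indicator integrable.\<close>

lemma emeasure_graph_polytope_finite:
  assumes "G \<in> connected_graphs n"
  shows "emeasure (Pi\<^sub>M {1..n} (\<lambda>_. lborel)) (graph_polytope n G) < \<infinity>"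
proof -
  interpret product_sigma_finite "\<lambda>_::nat. lborel :: real measure" ..
  let ?M = "Pi\<^sub>M {1..n} (\<lambda>_. lborel :: real measure)"
  have "\<exists>K. \<forall>x\<in>graph_polytope n G. \<bar>(x(0 := 0)) i\<bar> \<le> K" if "(0, i) \<in> {(i, j). {i, j} \<in> G}\<^sup>*" for i
    using that
  proof induction
    case base
    show ?case by (intro exI[of _ 0]) simp
  next
    case (step i j)
    then obtain K where K: "\<And>x. x \<in> graph_polytope n G \<Longrightarrow> \<bar>(x(0 := 0)) i\<bar> \<le> K" by blast
    have "\<bar>(x(0 := 0)) j\<bar> \<le> K + 1" if x: "x \<in> graph_polytope n G" for x
    proof -
      have "\<bar>(x(0 := 0)) i - (x(0 := 0)) j\<bar> \<le> 1"
        using x step.hyps(2) unfolding graph_polytope_def by blast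
      then show ?thesis using K[OF x] by linarith
    qed
    then show ?case by blast
  qed
  moreover have "(0, i) \<in> {(i, j). {i, j} \<in> G}\<^sup>*" if "i \<in> {1..n}" for i
    using that assms by (simp add: connected_graphs_def connected_graph_def)
  ultimately have "\<exists>K. \<forall>x\<in>graph_polytope n G. \<bar>(x(0 := 0)) i\<bar> \<le> K" if "i \<in> {1..n}" for i
    using that by blast
  moreover have "(x(0 := 0)) i = x i" if "i \<in> {1..n}" for i and x :: "nat \<Rightarrow> real"
    using that by simp
  ultimately have "\<exists>K. \<forall>x\<in>graph_polytope n G. \<bar>x i\<bar> \<le> K" if "i \<in> {1..n}" for i
    using that by metis
  then obtain K where K: "\<And>i x. i \<in> {1..n} \<Longrightarrow> x \<in> graph_polytope n G \<Longrightarrow> \<bar>x i\<bar> \<le> K i"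
    by metis
  have sub: "graph_polytope n G \<subseteq> Pi\<^sub>E {1..n} (\<lambda>i. {- K i..K i})"
  proof
    fix x assume x: "x \<in> graph_polytope n G"
    then have "x \<in> extensional {1..n}" by (simp add: graph_polytope_def PiE_def)
    moreover have "x i \<in> {- K i..K i}" if "i \<in> {1..n}" for i
      using K[OF that x] by (simp add: abs_le_iff)
    ultimately show "x \<in> Pi\<^sub>E {1..n} (\<lambda>i. {- K i..K i})" by (simp add: PiE_iff)
  qed
  have "emeasure ?M (graph_polytope n G) \<le> emeasure ?M (Pi\<^sub>E {1..n} (\<lambda>i. {- K i..K i}))"
    by (intro emeasure_mono sub sets_PiM_I_finite) auto
  also have "\<dots> = (\<Prod>i\<in>{1..n}. emeasure lborel {- K i..K i})"
    by (intro emeasure_PiM) auto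
  also have "\<dots> < \<infinity>"
    by (auto simp: emeasure_lborel_Icc_eq ennreal_prod_eq_top simp flip: less_top)
  finally show ?thesis .
qed

text \<open>A point lies in the polytope of \<open>G\<close> exactly when \<open>G\<close> is a
  subgraph of the unit interval graph of the point.\<close>

lemma mayer_sum_eq_sum_connected_graphs:
  assumes "x \<in> {1..n} \<rightarrow>\<^sub>E UNIV"
  shows "mayer_sum {0..n} (unit_interval_graph {0..n} (x(0 := 0))) =
    (\<Sum>G\<in>connected_graphs n. (-1) ^ card G * indicator (graph_polytope n G) x)"
proof -
  let ?H = "unit_interval_graph {0..n} (x(0 := 0))"
  have fin: "finite (simple_graphs n)"
    unfolding simple_graphs_def finite_Pow_iff by (rule finite_subset[of _ "Pow {0..n}"]) auto
  have spans: "spans {0..n} G = connected_graph n G" for G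
    by (simp add: spans_def connected_graph_def)
  have mem: "x \<in> graph_polytope n G \<longleftrightarrow> G \<subseteq> ?H" if G: "G \<in> simple_graphs n" for G
  proof
    assume x: "x \<in> graph_polytope n G"
    show "G \<subseteq> ?H"
    proof
      fix e assume "e \<in> G"
      with G have "e \<subseteq> {0..n}" "card e = 2" by (auto simp: simple_graphs_def)
      then obtain a b where e: "e = {a, b}" by (auto simp: card_2_iff)
      with x \<open>e \<in> G\<close> have "\<bar>(x(0 := 0)) a - (x(0 := 0)) b\<bar> \<le> 1"
        unfolding graph_polytope_def by blast
      then have "\<forall>i\<in>e. \<forall>j\<in>e. \<bar>(x(0 := 0)) i - (x(0 := 0)) j\<bar> \<le> 1"
        unfolding e by (auto simp: abs_minus_commute)
      then show "e \<in> ?H"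
        using \<open>e \<subseteq> {0..n}\<close> \<open>card e = 2\<close> by (simp add: unit_interval_graph_def)
    qed
  next
    assume "G \<subseteq> ?H"
    then show "x \<in> graph_polytope n G"
      using assms unfolding graph_polytope_def unit_interval_graph_def by blast
  qed
  have "mayer_sum {0..n} ?H = (\<Sum>G\<in>connected_graphs n \<inter> Pow ?H. (-1) ^ card G)"
  proof -
    have "connected_graphs n \<inter> Pow ?H = {G \<in> Pow ?H. spans {0..n} G}"
      by (auto simp: connected_graphs_def simple_graphs_def spans unit_interval_graph_def)
    moreover have "finite (Pow ?H)"
      by (rule finite_subset[OF _ fin]) (auto simp: simple_graphs_def unit_interval_graph_def)
    ultimately show ?thesis
      by (simp add: mayer_sum_def Int_def)
  qed
  also have "\<dots> = (\<Sum>G\<in>connected_graphs n. (-1) ^ card G * indicator (Pow ?H) G)"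
    using finite_connected_graphs by (simp add: indicator_def Int_def)
  also have "\<dots> = (\<Sum>G\<in>connected_graphs n. (-1) ^ card G * indicator (graph_polytope n G) x)"
    by (rule sum.cong) (auto simp: mem connected_graphs_def indicator_def)
  finally show ?thesis .
qed

theorem mainTheorem1:
  fixes n :: nat
  assumes "n \<ge> 1"
  shows "(\<Sum>G\<in>connected_graphs n. graph_weight n G) = (-1) ^ n * (real n + 1) ^ n"
proof -
  let ?M = "Pi\<^sub>M {1..n} (\<lambda>_. lborel :: real measure)"
  let ?P = "\<lambda>r x. parent_choices {0..n} ({0..n} - {r}) (x(0 := 0))"
  have "(\<Sum>G\<in>connected_graphs n. graph_weight n G) =
      (\<integral>x. (\<Sum>G\<in>connected_graphs n. (-1) ^ card G * indicator (graph_polytope n G) x) \<partial>?M)"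
  proof (subst Bochner_Integration.integral_sum)
    fix G assume G: "G \<in> connected_graphs n"
    then have "graph_polytope n G \<in> sets ?M"
      by (intro graph_polytope_measurable) (simp add: connected_graphs_def)
    then show "integrable ?M (\<lambda>x. (-1) ^ card G * indicator (graph_polytope n G) x :: real)"
      using emeasure_graph_polytope_finite[OF G] by simp
  next
    show "(\<Sum>G\<in>connected_graphs n. graph_weight n G) =
      (\<Sum>G\<in>connected_graphs n. \<integral>x. (-1) ^ card G * indicator (graph_polytope n G) x \<partial>?M)"
    proof (rule sum.cong)
      fix G assume G: "G \<in> connected_graphs n"
      then have "graph_polytope n G \<in> sets ?M"
        by (intro graph_polytope_measurable) (simp add: connected_graphs_def)
      then have "graph_polytope n G \<inter> space ?M = graph_polytope n G"
        by (simp add: sets.Int_space_eq2)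
      then show "graph_weight n G = (\<integral>x. (-1) ^ card G * indicator (graph_polytope n G) x \<partial>?M)"
        by (simp add: graph_weight_def graph_volume_def)
    qed simp
  qed
  also have "\<dots> = (\<integral>x. (-1) ^ n * real (\<Sum>r\<in>{0..n}. ?P r x) \<partial>?M)"
  proof (rule Bochner_Integration.integral_cong)
    fix x assume "x \<in> space ?M"
    then have "x \<in> {1..n} \<rightarrow>\<^sub>E UNIV" by (simp add: space_PiM)
    from mayer_sum_eq_sum_connected_graphs[OF this] mayer_sum_unit_interval_graph[of "{0..n}" "x(0 := 0)"]
    show "(\<Sum>G\<in>connected_graphs n. (-1) ^ card G * indicator (graph_polytope n G) x) =
        (-1) ^ n * real (\<Sum>r\<in>{0..n}. ?P r x)"
      by simp
  qed simp
  also have "\<dots> = (-1) ^ n * (\<integral>x. real (\<Sum>r\<in>{0..n}. ?P r x) \<partial>?M)"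
    by (rule integral_mult_right_zero)
  also have "(\<integral>x. real (\<Sum>r\<in>{0..n}. ?P r x) \<partial>?M) = (real n + 1) ^ n"
  proof -
    have meas: "(\<lambda>x. of_nat (?P r x) :: ennreal) \<in> borel_measurable ?M" for r
    proof (rule measurable_parent_choices)
      fix i assume "i \<in> {0..n} \<union> ({0..n} - {r})"
      then have "i = 0 \<or> i \<noteq> 0 \<and> i \<in> {1..n}" by auto
      then show "(\<lambda>x. (x(0 := 0)) i) \<in> borel_measurable ?M" by auto
    qed
    \<comment> \<open>The forest integrals live in \<open>ennreal\<close>; the integrand is
      nonnegative, so measurability and the value of the real integral are transferred from
      there.\<close>
    have sum_eq: "ennreal (real (\<Sum>r\<in>{0..n}. ?P r x)) = (\<Sum>r\<in>{0..n}. of_nat (?P r x))" for x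
      by (subst ennreal_of_nat_eq_real_of_nat[symmetric]) (rule of_nat_sum)
    have "(\<lambda>x. ennreal (real (\<Sum>r\<in>{0..n}. ?P r x))) \<in> borel_measurable ?M"
      unfolding sum_eq by (intro borel_measurable_sum meas)
    then have "(\<lambda>x. enn2real (ennreal (real (\<Sum>r\<in>{0..n}. ?P r x)))) \<in> borel_measurable ?M"
      by (rule borel_measurable_enn2real)
    then have "(\<lambda>x. real (\<Sum>r\<in>{0..n}. ?P r x)) \<in> borel_measurable ?M"
      by (simp only: enn2real_ennreal of_nat_0_le_iff)
    then have "(\<integral>x. real (\<Sum>r\<in>{0..n}. ?P r x) \<partial>?M) = enn2real (\<integral>\<^sup>+x. ennreal (real (\<Sum>r\<in>{0..n}. ?P r x)) \<partial>?M)"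
      by (intro integral_eq_nn_integral AE_I2 of_nat_0_le_iff)
    also have "(\<integral>\<^sup>+x. ennreal (real (\<Sum>r\<in>{0..n}. ?P r x)) \<partial>?M) = (\<Sum>r\<in>{0..n}. \<integral>\<^sup>+x. of_nat (?P r x) \<partial>?M)"
      unfolding sum_eq by (intro nn_integral_sum meas)
    also have "\<dots> = (\<Sum>r\<in>{0..n}. of_nat (forest_count n 1))"
      by (intro sum.cong nn_integral_parent_choices_root) auto
    also have "\<dots> = of_nat ((n + 1) ^ n)"
    proof -
      \<comment> \<open>Each of the n+1 roots contributes (n+1)^(n-1).\<close>
      have "(n + 1) * forest_count n 1 = (n + 1) ^ n"
        using assms by (cases n) (simp_all add: forest_count_def)
      moreover have "(\<Sum>r\<in>{0..n}. of_nat (forest_count n 1)) = (of_nat ((n + 1) * forest_count n 1) :: ennreal)"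
        by (simp only: sum_constant of_nat_mult) simp
      ultimately show ?thesis by simp
    qed
    also have "enn2real (of_nat ((n + 1) ^ n)) = (real n + 1) ^ n"
      by (simp only: ennreal_of_nat_eq_real_of_nat enn2real_ennreal of_nat_0_le_iff) (simp add: add.commute)
    finally show ?thesis .
  qed
  finally show ?thesis .
qed

end
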